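(* Let $\mathbf{w}:[n]\times[n]\to[0,1]$ be an edge weighting. Suppose that $$\sum_{\substack{i,j\in S\\ i<j}}w_{ij}\le |S|-1$$ for every nonempty vertex set $S\subseteq[n]$ that induces a clique in the positive-support graph of $\mathbf w$. Then $$\sum_{1\le i<j\le n}w_{ij}\le \left\lfloor\frac{n^2}{4}\right\rfloor.$$
   Context: An edge weighting is a map $\mathbf{w}:[n]\times[n]\to[0,1]$ with $w_{ij}=w_{ji}$ for $1\le i<j\le n$ and $w_{ii}=0$ for $1\le i\le n$. Its positive-support graph is the graph on $[n]$ in which $ij$ ($i\neq j$) is an edge exactly when $w_{ij}>0$. *)

theory Defs
  imports Complex_Main
begin

text \<open>
  The vertex set \<open>[n]\<close> is \<open>{1..n}\<close>. A weighting is a total function on pairs of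
  naturals; its values off \<open>[n] \<times> [n]\<close> are irrelevant and left unconstrained.
\<close>

definition edge_weighting :: "nat \<Rightarrow> (nat \<Rightarrow> nat \<Rightarrow> real) \<Rightarrow> bool" where
  "edge_weighting n w \<longleftrightarrow>
     (\<forall>i\<in>{1..n}. \<forall>j\<in>{1..n}. w i j \<in> {0..1}) \<and>
     (\<forall>i j. 1 \<le> i \<and> i < j \<and> j \<le> n \<longrightarrow> w i j = w j i) \<and>
     (\<forall>i\<in>{1..n}. w i i = 0)"

definition support_adj :: "nat \<Rightarrow> (nat \<Rightarrow> nat \<Rightarrow> real) \<Rightarrow> nat \<Rightarrow> nat \<Rightarrow> bool" where
  "support_adj n w i j \<longleftrightarrow> i \<in> {1..n} \<and> j \<in> {1..n} \<and> i \<noteq> j \<and> w i j > 0"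

definition support_clique :: "nat \<Rightarrow> (nat \<Rightarrow> nat \<Rightarrow> real) \<Rightarrow> nat set \<Rightarrow> bool" where
  "support_clique n w S \<longleftrightarrow> S \<subseteq> {1..n} \<and> pairwise (support_adj n w) S"

end

theory Submission
  imports Defs
begin

text \<open>
  The proof is Zykov symmetrisation with integer vertex multiplicities. Give every vertex \<open>i\<close> a
  multiplicity \<open>m i\<close> and consider the quadratic form \<open>\<Sum> w i j * m i * m j\<close>; the theorem is the
  case \<open>m = 1\<close>. If two vertices \<open>i\<close>, \<open>j\<close> carry an edge of weight \<open>0\<close>, the form is affine along
  the direction that moves multiplicity from one to the other, so moving all of it to the better
  endpoint does not decrease the form, keeps the total multiplicity and removes a vertex
  (\<open>quadratic_form_le_merge\<close>). Iterating, only a clique of the positive-support graph remains.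
  Working with integers throughout, rather than with the continuous simplex of Motzkin and
  Straus, is what produces the floor in the bound.

  On a clique the hypothesis holds for all nonempty subsets, so that \<open>w\<close> lies in the forest
  polytope of the complete graph. A maximum-weight forest for the edge costs \<open>m i * m j\<close> is a star
  centred at a vertex of maximal multiplicity \<open>\<mu>\<close>, of cost \<open>\<mu> * (M - \<mu>)\<close> with \<open>M\<close> the total
  multiplicity; and \<open>\<mu> * (M - \<mu>)\<close> is at most the integer part of \<open>M\<^sup>2 / 4\<close>. That the star is optimal
  also against fractional forests follows from \<open>m i * m j \<le> \<mu> * min (m i) (m j)\<close> and a
  decomposition of \<open>min (m i) (m j)\<close> into level sets (\<open>sum_min_le_of_forest_bounds\<close>).

  Sums run over ordered pairs, which doubles all the bounds.
\<close>

section \<open>The star bound on a clique\<close>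

lemma min_eq_sum_levels:
  fixes a b \<mu> :: nat
  assumes "a \<le> \<mu>"
  shows "real (min a b) = (\<Sum>t<\<mu>. of_bool (t < a) * of_bool (t < b))"
proof -
  have "(\<Sum>t<\<mu>. of_bool (t < a) * of_bool (t < b)) = (\<Sum>t<\<mu>. of_bool (t < min a b) :: real)"
    by (intro sum.cong) auto
  also have "\<dots> = real (card ({..<\<mu>} \<inter> {t. t < min a b}))"
    by simp
  also have "{..<\<mu>} \<inter> {t. t < min a b} = {..<min a b}"
    using assms by auto
  finally show ?thesis by simp
qed

text \<open>
  The multiplicities are cut into level sets \<open>S\<^sub>t = {i \<in> S. t < m i}\<close>. A pair lies in exactly
  \<open>min (m i) (m j)\<close> of them, each of the \<open>Max (m ` S)\<close> nonempty levels satisfies the forest bound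
  \<open>card S\<^sub>t - 1\<close>, and the sizes of the levels add up to the total multiplicity.
\<close>

lemma sum_min_le_of_forest_bounds:
  fixes w :: "'a \<Rightarrow> 'a \<Rightarrow> real" and m :: "'a \<Rightarrow> nat"
  assumes "finite S" "S \<noteq> {}"
    and forest: "\<And>T. T \<subseteq> S \<Longrightarrow> T \<noteq> {} \<Longrightarrow>
                   (\<Sum>i\<in>T. \<Sum>j\<in>T. w i j) \<le> 2 * (real (card T) - 1)"
  shows "(\<Sum>i\<in>S. \<Sum>j\<in>S. w i j * real (min (m i) (m j)))
           \<le> 2 * (real (sum m S) - real (Max (m ` S)))"
proof -
  define \<mu> where "\<mu> = Max (m ` S)"
  define L where "L t = {i\<in>S. t < m i}" for t
  have m_le: "m i \<le> \<mu>" if "i \<in> S" for i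
    using that assms(1) by (simp add: \<mu>_def)
  have level: "(\<Sum>i\<in>S. \<Sum>j\<in>S. w i j * (of_bool (t < m i) * of_bool (t < m j)))
                 = (\<Sum>i\<in>L t. \<Sum>j\<in>L t. w i j)" for t
  proof -
    have "(\<Sum>i\<in>L t. \<Sum>j\<in>L t. w i j)
            = (\<Sum>i\<in>S. if t < m i then \<Sum>j\<in>S. if t < m j then w i j else 0 else 0)"
      unfolding L_def using assms(1) by (simp add: sum.inter_filter)
    also have "\<dots> = (\<Sum>i\<in>S. \<Sum>j\<in>S. w i j * (of_bool (t < m i) * of_bool (t < m j)))"
      by (intro sum.cong refl) (auto intro!: sum.cong)
    finally show ?thesis ..
  qed
  have L_nonempty: "L t \<noteq> {}" if "t < \<mu>" for t
  proof -
    have "\<mu> \<in> m ` S"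
      unfolding \<mu>_def using assms(1,2) by (intro Max_in) auto
    with that show ?thesis by (auto simp: L_def)
  qed
  have "(\<Sum>i\<in>S. \<Sum>j\<in>S. w i j * real (min (m i) (m j)))
          = (\<Sum>i\<in>S. \<Sum>j\<in>S. \<Sum>t<\<mu>. w i j * (of_bool (t < m i) * of_bool (t < m j)))"
    using m_le by (intro sum.cong refl) (simp only: min_eq_sum_levels[where \<mu> = \<mu>] sum_distrib_left)
  also have "\<dots> = (\<Sum>i\<in>S. \<Sum>t<\<mu>. \<Sum>j\<in>S. w i j * (of_bool (t < m i) * of_bool (t < m j)))"
    by (intro sum.cong refl sum.swap)
  also have "\<dots> = (\<Sum>t<\<mu>. \<Sum>i\<in>S. \<Sum>j\<in>S. w i j * (of_bool (t < m i) * of_bool (t < m j)))"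
    by (rule sum.swap)
  also have "\<dots> = (\<Sum>t<\<mu>. \<Sum>i\<in>L t. \<Sum>j\<in>L t. w i j)"
    by (simp only: level)
  also have "\<dots> \<le> (\<Sum>t<\<mu>. 2 * (real (card (L t)) - 1))"
    using L_nonempty by (intro sum_mono forest) (auto simp: L_def)
  also have "\<dots> = 2 * ((\<Sum>t<\<mu>. real (card (L t))) - real \<mu>)"
    by (simp add: sum_distrib_left[symmetric] sum_subtractf)
  also have "(\<Sum>t<\<mu>. real (card (L t))) = real (sum m S)"
  proof -
    have "(\<Sum>t<\<mu>. real (card (L t))) = (\<Sum>t<\<mu>. \<Sum>i\<in>S. of_bool (t < m i))"
      using assms(1) by (simp add: L_def Collect_conj_eq Int_commute)
    also have "\<dots> = (\<Sum>i\<in>S. \<Sum>t<\<mu>. of_bool (t < m i) * of_bool (t < m i))"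
      by (subst sum.swap) (intro sum.cong refl, simp)
    also have "\<dots> = (\<Sum>i\<in>S. real (min (m i) (m i)))"
      using m_le by (intro sum.cong refl) (simp only: min_eq_sum_levels[where \<mu> = \<mu>])
    finally show ?thesis by simp
  qed
  finally show ?thesis by (simp add: \<mu>_def)
qed

lemma mult_diff_le_square_div_4:
  fixes a M :: nat
  assumes "a \<le> M"
  shows "a * (M - a) \<le> M\<^sup>2 div 4"
proof -
  obtain b where M: "M = a + b"
    using assms le_Suc_ex by blast
  have "int (4 * (a * b)) \<le> int ((a + b)\<^sup>2)"
    using zero_le_power2[of "int a - int b"] by (simp add: power2_eq_square algebra_simps)
  then have "4 * (a * b) \<le> (a + b)\<^sup>2"
    by (simp only: of_nat_le_iff)
  then show ?thesis by (simp add: M)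
qed

text \<open>
  Writing \<open>m i * m j\<close> as maximum times minimum and bounding the maximum by \<open>\<mu> = Max (m ` S)\<close>
  replaces the form by one that the level sets control. The resulting bound \<open>2 * \<mu> * (M - \<mu>)\<close> is
  attained by the star with all weights \<open>1\<close> at a vertex of multiplicity \<open>\<mu>\<close>.
\<close>

lemma quadratic_form_le_of_forest_bounds:
  fixes w :: "'a \<Rightarrow> 'a \<Rightarrow> real" and m :: "'a \<Rightarrow> nat"
  assumes "finite S"
    and nonneg: "\<And>i j. i \<in> S \<Longrightarrow> j \<in> S \<Longrightarrow> 0 \<le> w i j"
    and forest: "\<And>T. T \<subseteq> S \<Longrightarrow> T \<noteq> {} \<Longrightarrow>
                   (\<Sum>i\<in>T. \<Sum>j\<in>T. w i j) \<le> 2 * (real (card T) - 1)"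
  shows "(\<Sum>i\<in>S. \<Sum>j\<in>S. w i j * real (m i) * real (m j)) \<le> 2 * real ((sum m S)\<^sup>2 div 4)"
proof (cases "S = {}")
  case False
  define \<mu> where "\<mu> = Max (m ` S)"
  have m_le: "m i \<le> \<mu>" if "i \<in> S" for i
    using that assms(1) by (simp add: \<mu>_def)
  have \<mu>_le: "\<mu> \<le> sum m S"
  proof -
    have "\<mu> \<in> m ` S"
      unfolding \<mu>_def using assms(1) False by (intro Max_in) auto
    then show ?thesis using assms(1) by (auto intro: member_le_sum)
  qed
  have prod_le: "real (m i) * real (m j) \<le> real \<mu> * real (min (m i) (m j))"
    if "i \<in> S" "j \<in> S" for i j
  proof -
    have "m i * m j = max (m i) (m j) * min (m i) (m j)"
      by (simp add: max_def min_def)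
    also have "\<dots> \<le> \<mu> * min (m i) (m j)"
      using m_le that by (intro mult_right_mono) auto
    finally show ?thesis by (metis of_nat_le_iff of_nat_mult)
  qed
  have "(\<Sum>i\<in>S. \<Sum>j\<in>S. w i j * real (m i) * real (m j))
          \<le> (\<Sum>i\<in>S. \<Sum>j\<in>S. real \<mu> * (w i j * real (min (m i) (m j))))"
  proof (intro sum_mono)
    fix i j assume "i \<in> S" "j \<in> S"
    from mult_left_mono[OF prod_le[OF this] nonneg[OF this]]
    show "w i j * real (m i) * real (m j) \<le> real \<mu> * (w i j * real (min (m i) (m j)))"
      by (simp add: mult_ac)
  qed
  also have "\<dots> = real \<mu> * (\<Sum>i\<in>S. \<Sum>j\<in>S. w i j * real (min (m i) (m j)))"
    by (simp add: sum_distrib_left)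
  also have "\<dots> \<le> real \<mu> * (2 * (real (sum m S) - real \<mu>))"
    unfolding \<mu>_def using assms(1) False forest
    by (intro mult_left_mono sum_min_le_of_forest_bounds) auto
  also have "\<dots> = 2 * real (\<mu> * (sum m S - \<mu>))"
    using \<mu>_le by (simp only: of_nat_mult of_nat_diff)
  also have "\<dots> \<le> 2 * real ((sum m S)\<^sup>2 div 4)"
    using mult_diff_le_square_div_4[OF \<mu>_le]
    by (intro mult_left_mono of_nat_mono) auto
  finally show ?thesis .
qed simp

section \<open>Symmetrisation\<close>

lemma quadratic_form_insert:
  fixes w :: "'a \<Rightarrow> 'a \<Rightarrow> real" and x :: "'a \<Rightarrow> real"
  assumes "finite U" "k \<notin> U" "w k k = 0" "\<And>u. u \<in> U \<Longrightarrow> w u k = w k u"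
  shows "(\<Sum>i\<in>insert k U. \<Sum>j\<in>insert k U. w i j * x i * x j)
           = (\<Sum>i\<in>U. \<Sum>j\<in>U. w i j * x i * x j) + 2 * x k * (\<Sum>u\<in>U. w k u * x u)"
  using assms by (simp add: sum.distrib sum_distrib_left mult_ac)

text \<open>
  Since \<open>w i i = w j j = w i j = 0\<close>, the form has no quadratic term in \<open>m i\<close> and \<open>m j\<close>: it is affine
  in \<open>(m i, m j)\<close>, with coefficients twice the weighted degrees of \<open>i\<close> and \<open>j\<close> into \<open>U\<close>. Hence all multiplicity
  may be moved to the vertex of larger degree.
\<close>

lemma quadratic_form_le_merge:
  fixes w :: "'a \<Rightarrow> 'a \<Rightarrow> real" and m :: "'a \<Rightarrow> nat"
  assumes "finite U" "i \<notin> U" "j \<notin> U" "i \<noteq> j"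
    and sym: "\<And>a b. a \<in> insert i (insert j U) \<Longrightarrow> b \<in> insert i (insert j U) \<Longrightarrow> w a b = w b a"
    and zero: "w i i = 0" "w j j = 0" "w i j = 0"
    and degree: "(\<Sum>u\<in>U. w j u * real (m u)) \<le> (\<Sum>u\<in>U. w i u * real (m u))"
  defines "m' \<equiv> m(i := m i + m j)"
  shows "(\<Sum>a\<in>insert j (insert i U). \<Sum>b\<in>insert j (insert i U). w a b * real (m a) * real (m b))
           \<le> (\<Sum>a\<in>insert i U. \<Sum>b\<in>insert i U. w a b * real (m' a) * real (m' b))"
proof -
  have m'_eq: "m' u = m u" if "u \<in> U" for u
    using that assms(2) by (auto simp: m'_def)
  have "w j i = 0"
    using sym[of j i] zero by simp
  then have "(\<Sum>a\<in>insert j (insert i U). \<Sum>b\<in>insert j (insert i U). w a b * real (m a) * real (m b))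
     = (\<Sum>a\<in>U. \<Sum>b\<in>U. w a b * real (m a) * real (m b))
         + 2 * real (m i) * (\<Sum>u\<in>U. w i u * real (m u))
         + 2 * real (m j) * (\<Sum>u\<in>U. w j u * real (m u))"
    using assms
    by (subst quadratic_form_insert[where k = j]; (subst quadratic_form_insert[where k = i])?) auto
  also have "\<dots> \<le> (\<Sum>a\<in>U. \<Sum>b\<in>U. w a b * real (m a) * real (m b))
         + 2 * real (m i) * (\<Sum>u\<in>U. w i u * real (m u))
         + 2 * real (m j) * (\<Sum>u\<in>U. w i u * real (m u))"
    using degree by (intro add_left_mono mult_left_mono) auto
  also have "\<dots> = (\<Sum>a\<in>U. \<Sum>b\<in>U. w a b * real (m' a) * real (m' b))
         + 2 * real (m' i) * (\<Sum>u\<in>U. w i u * real (m' u))"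
    using m'_eq by (simp add: m'_def algebra_simps)
  also have "\<dots> = (\<Sum>a\<in>insert i U. \<Sum>b\<in>insert i U. w a b * real (m' a) * real (m' b))"
    using assms by (subst quadratic_form_insert) auto
  finally show ?thesis .
qed

text \<open>
  Arbitrary multiplicities are what makes induction on the number of vertices possible: a merge
  deletes a vertex, while \<open>w\<close>, its cliques and the total multiplicity are inherited.
\<close>

theorem quadratic_form_le_of_clique_bounds:
  fixes w :: "'a \<Rightarrow> 'a \<Rightarrow> real" and m :: "'a \<Rightarrow> nat"
  assumes "finite V"
    and "\<And>i j. i \<in> V \<Longrightarrow> j \<in> V \<Longrightarrow> 0 \<le> w i j"
    and "\<And>i j. i \<in> V \<Longrightarrow> j \<in> V \<Longrightarrow> w i j = w j i"
    and "\<And>i. i \<in> V \<Longrightarrow> w i i = 0"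
    and "\<And>S. S \<subseteq> V \<Longrightarrow> S \<noteq> {} \<Longrightarrow> pairwise (\<lambda>i j. 0 < w i j) S \<Longrightarrow>
           (\<Sum>i\<in>S. \<Sum>j\<in>S. w i j) \<le> 2 * (real (card S) - 1)"
  shows "(\<Sum>i\<in>V. \<Sum>j\<in>V. w i j * real (m i) * real (m j)) \<le> 2 * real ((sum m V)\<^sup>2 div 4)"
  using assms
proof (induction "card V" arbitrary: V m rule: less_induct)
  case less
  note nonneg = less.prems(2) and sym = less.prems(3) and diag = less.prems(4)
    and clique = less.prems(5)
  show ?case
  proof (cases "pairwise (\<lambda>i j. 0 < w i j) V")
    case True
    show ?thesis
      using less.prems(1) nonneg clique pairwise_subset[OF True]
      by (intro quadratic_form_le_of_forest_bounds) auto
  next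
    case False
    then obtain p q where pq: "p \<in> V" "q \<in> V" "p \<noteq> q" "w p q = 0"
      using nonneg unfolding pairwise_def by (metis less_eq_real_def)
    define d where "d k = (\<Sum>u\<in>V - {p, q}. w k u * real (m u))" for k
    obtain i j where ij: "i \<in> V" "j \<in> V" "i \<noteq> j" "w i j = 0" "{i, j} = {p, q}" "d j \<le> d i"
    proof (cases "d q \<le> d p")
      case True
      with pq show ?thesis by (intro that[of p q]) auto
    next
      case False
      with pq sym[of p q] show ?thesis by (intro that[of q p]) auto
    qed
    define U where "U = V - {i, j}"
    define m' where "m' = m(i := m i + m j)"
    have U: "finite U" "i \<notin> U" "j \<notin> U" and V: "V = insert j (insert i U)"
      using less.prems(1) ij by (auto simp: U_def)
    have sub: "insert i U \<subseteq> V"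
      using V by auto
    have total: "sum m' (insert i U) = sum m V"
    proof -
      have "sum m' U = sum m U"
        using U(2) by (intro sum.cong) (auto simp: m'_def)
      then show ?thesis using U ij(3) by (simp add: V m'_def)
    qed
    have "(\<Sum>a\<in>V. \<Sum>b\<in>V. w a b * real (m a) * real (m b))
            \<le> (\<Sum>a\<in>insert i U. \<Sum>b\<in>insert i U. w a b * real (m' a) * real (m' b))"
      unfolding V m'_def
    proof (rule quadratic_form_le_merge)
      show "(\<Sum>u\<in>U. w j u * real (m u)) \<le> (\<Sum>u\<in>U. w i u * real (m u))"
        using ij(5,6) by (simp add: d_def U_def)
    qed (use U ij V sym diag in auto)
    also have "\<dots> \<le> 2 * real ((sum m' (insert i U))\<^sup>2 div 4)"
    proof (rule less.hyps)
      show "card (insert i U) < card V"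
        using U ij(3) by (simp add: V)
      fix S assume "S \<subseteq> insert i U" "S \<noteq> {}" "pairwise (\<lambda>a b. 0 < w a b) S"
      with sub show "(\<Sum>a\<in>S. \<Sum>b\<in>S. w a b) \<le> 2 * (real (card S) - 1)"
        by (intro clique) auto
    next
      show "finite (insert i U)" using U(1) by simp
      show "0 \<le> w a b" if "a \<in> insert i U" "b \<in> insert i U" for a b
        using that by (intro nonneg subsetD[OF sub])
      show "w a b = w b a" if "a \<in> insert i U" "b \<in> insert i U" for a b
        using that by (intro sym subsetD[OF sub])
      show "w a a = 0" if "a \<in> insert i U" for a
        using that by (intro diag subsetD[OF sub])
    qed
    finally show ?thesis by (simp only: total)
  qed
qed

section \<open>From ordered to unordered pairs\<close>

lemma sum_ordered_pairs_eq_twice: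
  fixes w :: "'a::linorder \<Rightarrow> 'a \<Rightarrow> real"
  assumes "finite S"
    and sym: "\<And>i j. i \<in> S \<Longrightarrow> j \<in> S \<Longrightarrow> w i j = w j i"
    and diag: "\<And>i. i \<in> S \<Longrightarrow> w i i = 0"
  shows "(\<Sum>i\<in>S. \<Sum>j\<in>S. w i j) = 2 * (\<Sum>(i, j) | i \<in> S \<and> j \<in> S \<and> i < j. w i j)"
proof -
  define f where "f i j = (if i < j then w i j else 0)" for i j
  have upper: "(\<Sum>(i, j) | i \<in> S \<and> j \<in> S \<and> i < j. w i j) = (\<Sum>i\<in>S. \<Sum>j\<in>S. f i j)"
  proof -
    have "{(i, j). i \<in> S \<and> j \<in> S \<and> i < j} = {p \<in> S \<times> S. fst p < snd p}"
      by auto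
    then have "(\<Sum>(i, j) | i \<in> S \<and> j \<in> S \<and> i < j. w i j)
                 = (\<Sum>p\<in>S \<times> S. if fst p < snd p then w (fst p) (snd p) else 0)"
      using assms(1) by (simp add: sum.inter_filter case_prod_beta)
    also have "\<dots> = (\<Sum>i\<in>S. \<Sum>j\<in>S. f i j)"
      by (simp add: sum.cartesian_product case_prod_beta f_def)
    finally show ?thesis .
  qed
  have "(\<Sum>i\<in>S. \<Sum>j\<in>S. w i j) = (\<Sum>i\<in>S. \<Sum>j\<in>S. f i j + f j i)"
  proof (intro sum.cong refl)
    fix i j assume "i \<in> S" "j \<in> S"
    then show "w i j = f i j + f j i"
      using sym[of i j] diag by (cases i j rule: linorder_cases) (auto simp: f_def)
  qed
  also have "\<dots> = 2 * (\<Sum>i\<in>S. \<Sum>j\<in>S. f i j)"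
    using sum.swap[of "\<lambda>i j. f j i" S S] by (simp add: sum.distrib)
  finally show ?thesis by (simp only: upper)
qed

theorem lemma2p2:
  fixes n :: nat and w :: "nat \<Rightarrow> nat \<Rightarrow> real"
  assumes "edge_weighting n w"
    and "\<And>S. S \<subseteq> {1..n} \<Longrightarrow> S \<noteq> {} \<Longrightarrow> support_clique n w S \<Longrightarrow>
           (\<Sum>(i, j) | i \<in> S \<and> j \<in> S \<and> i < j. w i j) \<le> real (card S) - 1"
  shows "(\<Sum>(i, j) | 1 \<le> i \<and> i < j \<and> j \<le> n. w i j) \<le> real_of_int \<lfloor>(real n)\<^sup>2 / 4\<rfloor>"
proof -
  let ?V = "{1..n}"
  have nonneg: "0 \<le> w i j" if "i \<in> ?V" "j \<in> ?V" for i j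
    using assms(1) that unfolding edge_weighting_def by (meson atLeastAtMost_iff)
  have sym: "w i j = w j i" if "i \<in> ?V" "j \<in> ?V" for i j
    using assms(1) that unfolding edge_weighting_def
    by (cases i j rule: linorder_cases) auto
  have diag: "w i i = 0" if "i \<in> ?V" for i
    using assms(1) that unfolding edge_weighting_def by blast
  have twice: "(\<Sum>i\<in>S. \<Sum>j\<in>S. w i j) = 2 * (\<Sum>(i, j) | i \<in> S \<and> j \<in> S \<and> i < j. w i j)"
    if "S \<subseteq> ?V" for S
    using that sym diag
    by (intro sum_ordered_pairs_eq_twice finite_subset[OF that]) blast+
  have "(\<Sum>i\<in>?V. \<Sum>j\<in>?V. w i j * real 1 * real 1) \<le> 2 * real ((\<Sum>i\<in>?V. 1)\<^sup>2 div 4)"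
  proof (rule quadratic_form_le_of_clique_bounds)
    fix S assume S: "S \<subseteq> ?V" "S \<noteq> {}" "pairwise (\<lambda>i j. 0 < w i j) S"
    then have "support_clique n w S"
      by (auto simp: support_clique_def support_adj_def pairwise_def subset_eq)
    with assms(2)[OF S(1,2)] twice[OF S(1)]
    show "(\<Sum>i\<in>S. \<Sum>j\<in>S. w i j) \<le> 2 * (real (card S) - 1)" by simp
  qed (use nonneg sym diag in \<open>(blast intro: finite_atLeastAtMost)+\<close>)
  then have "(\<Sum>(i, j) | i \<in> ?V \<and> j \<in> ?V \<and> i < j. w i j) \<le> real (n\<^sup>2 div 4)"
    using twice[of ?V] by simp
  also have "{(i, j). i \<in> ?V \<and> j \<in> ?V \<and> i < j} = {(i, j). 1 \<le> i \<and> i < j \<and> j \<le> n}"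
    by auto
  also have "real (n\<^sup>2 div 4) = real_of_int \<lfloor>(real n)\<^sup>2 / 4\<rfloor>"
    using floor_divide_of_nat_eq[where 'a = real, of "n\<^sup>2" 4] by simp
  finally show ?thesis .
qed

end
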